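(* Let $n\ge 2$ and let $S_n=K_{1,n-1}$ be the star graph on $n$ vertices. Then: (i) the elliptic Sombor characteristic polynomial of $S_n$ is $$\phi_{ESO}(S_n,\lambda)=\lambda^{n-2}\left(\lambda^2-(n-1)(n^4-2n^3+2n^2)\right);$$ (ii) the elliptic Sombor energy of $S_n$ is $$E_{ESO}(S_n)=2n\sqrt{(n-1)(n^2-2n+2)}.$$
   Context: For a simple graph $G$ with vertex set $\{v_1,\ldots,v_n\}$, let $d_i$ denote the degree of $v_i$. The elliptic Sombor matrix $A_{ESO}(G)$ is the $n\times n$ real symmetric matrix whose $(i,j)$-entry is $(d_i+d_j)\sqrt{d_i^2+d_j^2}$ if $v_i$ and $v_j$ are adjacent, and $0$ otherwise. The elliptic Sombor characteristic polynomial is $\phi_{ESO}(G,\lambda)=\det(\lambda I-A_{ESO}(G))$, and the elliptic Sombor energy is $E_{ESO}(G)=\sum_{i=1}^n|\lambda_i|$, where $\lambda_1,\ldots,\lambda_n$ are the eigenvalues of $A_{ESO}(G)$ counted with multiplicity. *)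

theory Defs
  imports
    Complex_Main
    "Graph_Theory.Digraph"
    "Graph_Theory.Kuratowski"
    "Jordan_Normal_Form.Char_Poly"
begin

text \<open>
  A simple graph is a \<^locale>\<open>graph\<close>: a finite symmetric digraph without loops or
  parallel arcs, each edge being represented by its two opposite arcs. Hence the degree
  of a vertex is its \<^const>\<open>out_degree\<close>, and adjacency is membership in
  \<^const>\<open>arcs_ends\<close>. The enumeration of the vertices is the argument \<open>v\<close>, meant to be a
  bijection from \<open>{..<n}\<close> onto \<open>verts G\<close> (indices start at 0).
\<close>

definition eso_matrix :: "('a, 'b) pre_digraph \<Rightarrow> (nat \<Rightarrow> 'a) \<Rightarrow> real mat" where
  "eso_matrix G v = mat (card (verts G)) (card (verts G))
     (\<lambda>(i, j). if (v i, v j) \<in> arcs_ends G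
       then (real (out_degree G (v i)) + real (out_degree G (v j)))
            * sqrt (real (out_degree G (v i)) ^ 2 + real (out_degree G (v j)) ^ 2)
       else 0)"

definition eso_char_poly :: "('a, 'b) pre_digraph \<Rightarrow> (nat \<Rightarrow> 'a) \<Rightarrow> real poly" where
  "eso_char_poly G v = char_poly (eso_matrix G v)"

text \<open>
  The multiplicity of an eigenvalue is its order as a root of the characteristic
  polynomial. Summing over real eigenvalues only loses nothing: for a graph the matrix is
  real symmetric, so its characteristic polynomial splits over the reals.
\<close>

definition eso_energy :: "('a, 'b) pre_digraph \<Rightarrow> (nat \<Rightarrow> 'a) \<Rightarrow> real" where
  "eso_energy G v = (\<Sum>x | eigenvalue (eso_matrix G v) x. real (order x (eso_char_poly G v)) * \<bar>x\<bar>)"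

definition star_graph :: "nat \<Rightarrow> ('a, 'b) pre_digraph \<Rightarrow> bool" where
  "star_graph n G \<longleftrightarrow> complete_bipartite_digraph 1 (n - 1) G"

end

theory Submission
  imports Defs
begin

text \<open>
  Every edge of the star joins the hub, of degree \<open>n - 1\<close>, to a leaf, of degree 1, so the
  elliptic Sombor matrix of the star is the ordinary adjacency matrix scaled by the single edge
  weight \<open>n * sqrt ((n - 1)^2 + 1)\<close> (lemma \<open>star_graph_eso_matrix\<close>).

  On the leaves the characteristic matrix is \<open>X\<close> times the identity, and clearing the hub column
  against it turns the hub entry, after scaling by \<open>X\<close>, into \<open>X^2\<close> minus the sum of the
  squared weights (lemma \<open>char_poly_weighted_star\<close>). With \<open>s^2\<close> for that sum, the characteristic
  polynomial is \<open>X^(n - 2) * (X - s) * (X + s)\<close>. Its nonzero roots \<open>s\<close> and \<open>-s\<close> are simple, and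
  the root 0 does not count towards the energy whatever its multiplicity, so the energy is
  \<open>2 * s\<close> (lemma \<open>abs_root_sum_even_quadratic\<close>).
\<close>

section \<open>Weighted stars\<close>

text \<open>
  The hub may have any index \<open>k\<close>, since the enumeration of the vertices is arbitrary.
\<close>

definition weighted_star_mat :: "nat \<Rightarrow> nat \<Rightarrow> (nat \<Rightarrow> 'a :: comm_ring_1) \<Rightarrow> 'a mat" where
  "weighted_star_mat n k w = mat n n
     (\<lambda>(i, j). if i = k \<and> j \<noteq> k then w j else if i \<noteq> k \<and> j = k then w i else 0)"

lemma weighted_star_mat_carrier [simp]: "weighted_star_mat n k w \<in> carrier_mat n n"
  by (simp add: weighted_star_mat_def)

lemma det_col_single:
  fixes A :: "'a :: comm_ring_1 mat"
  assumes A: "A \<in> carrier_mat n n" and k: "k < n"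
    and zero: "\<And>i. i < n \<Longrightarrow> i \<noteq> k \<Longrightarrow> A $$ (i, k) = 0"
  shows "det A = A $$ (k, k) * det (mat_delete A k k)"
proof -
  have "det A = (\<Sum>i<n. A $$ (i, k) * cofactor A i k)"
    by (rule laplace_expansion_column[OF A k])
  also have "\<dots> = (\<Sum>i\<in>{k}. A $$ (i, k) * cofactor A i k)"
    by (rule sum.mono_neutral_right) (use k zero in auto)
  finally show ?thesis
    by (simp add: cofactor_def)
qed

lemma det_row_single:
  fixes A :: "'a :: comm_ring_1 mat"
  assumes A: "A \<in> carrier_mat n n" and k: "k < n"
    and zero: "\<And>j. j < n \<Longrightarrow> j \<noteq> k \<Longrightarrow> A $$ (k, j) = 0"
  shows "det A = A $$ (k, k) * det (mat_delete A k k)"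
proof -
  have "det A = (\<Sum>j<n. A $$ (k, j) * cofactor A k j)"
    by (rule laplace_expansion_row[OF A k])
  also have "\<dots> = (\<Sum>j\<in>{k}. A $$ (k, j) * cofactor A k j)"
    by (rule sum.mono_neutral_right) (use k zero in auto)
  finally show ?thesis
    by (simp add: cofactor_def)
qed

lemma det_scalar_mat: "det (x \<cdot>\<^sub>m 1\<^sub>m n) = (x :: 'a :: comm_ring_1) ^ n"
  by (simp add: det_smult)

lemma mat_delete_eq_scalar:
  fixes A :: "'a :: comm_ring_1 mat"
  assumes A: "A \<in> carrier_mat n n" and k: "k < n"
    and off: "\<And>i j. i < n \<Longrightarrow> j < n \<Longrightarrow> i \<noteq> k \<Longrightarrow> j \<noteq> k \<Longrightarrow> A $$ (i, j) = (if i = j then x else 0)"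
  shows "mat_delete A k k = x \<cdot>\<^sub>m 1\<^sub>m (n - 1)"
  using A k by (intro eq_matI) (auto simp: mat_delete_def off)

text \<open>
  The hub column of the characteristic matrix \<open>M\<close> could be cleared off the diagonal by adding to
  it \<open>w i / X\<close> times each leaf column \<open>i\<close>. Multiplying through by \<open>X\<close> keeps this inside the
  polynomial ring: the operation becomes right multiplication by a matrix \<open>P\<close> of determinant \<open>X\<close>,
  and one factor \<open>X\<close> is cancelled at the end.
\<close>

lemma char_poly_weighted_star:
  fixes w :: "nat \<Rightarrow> 'a :: idom"
  assumes k: "k < n" and n: "n \<ge> 2"
  shows "char_poly (weighted_star_mat n k w) =
    [:0, 1:] ^ (n - 2) * ([:0, 1:] ^ 2 - [:\<Sum>i\<in>{..<n} - {k}. w i ^ 2:])"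
proof -
  let ?X = "[:0, 1:] :: 'a poly"
  define M where "M = char_poly_matrix (weighted_star_mat n k w)"
  define P where "P = mat n n (\<lambda>(i, j). if j = k then (if i = k then ?X else [:w i:])
                                 else if i = j then 1 else 0)"
  have M: "M \<in> carrier_mat n n" and P: "P \<in> carrier_mat n n"
    by (simp_all add: M_def P_def)
  have Mij: "M $$ (i, j) = (if i = j then ?X else if i = k then [:- w j:]
                             else if j = k then [:- w i:] else 0)"
    if "i < n" "j < n" for i j
    using that by (auto simp: M_def char_poly_matrix_def weighted_star_mat_def)
  have MP: "(M * P) $$ (i, j) = (\<Sum>l<n. M $$ (i, l) * P $$ (l, j))" if "i < n" "j < n" for i j
    using that M P by (simp add: times_mat_def scalar_prod_def lessThan_atLeast0)
  have split: "(\<Sum>l<n. f l) = f k + (\<Sum>l\<in>{..<n} - {k}. f l)" for f :: "nat \<Rightarrow> 'a poly"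
    using k by (simp add: sum.remove)
  have other: "(M * P) $$ (i, j) = M $$ (i, j)" if "i < n" "j < n" "j \<noteq> k" for i j
  proof -
    have "(M * P) $$ (i, j) = (\<Sum>l\<in>{j}. M $$ (i, l) * P $$ (l, j))"
      unfolding MP[OF that(1,2)]
      by (rule sum.mono_neutral_right) (use that in \<open>auto simp: P_def\<close>)
    then show ?thesis using that by (simp add: P_def)
  qed
  have leaf: "(M * P) $$ (i, k) = 0" if "i < n" "i \<noteq> k" for i
  proof -
    have "(\<Sum>l\<in>{..<n} - {k}. M $$ (i, l) * P $$ (l, k)) = (\<Sum>l\<in>{i}. M $$ (i, l) * P $$ (l, k))"
      by (rule sum.mono_neutral_right) (use that in \<open>auto simp: Mij\<close>)
    then show ?thesis
      unfolding MP[OF that(1) k] split using that k by (simp add: Mij P_def)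
  qed
  have const: "(\<Sum>l\<in>S. [:f l:]) = [:\<Sum>l\<in>S. f l:]" for f :: "nat \<Rightarrow> 'a" and S
    by (induction S rule: infinite_finite_induct) auto
  have hub: "(M * P) $$ (k, k) = ?X ^ 2 - [:\<Sum>i\<in>{..<n} - {k}. w i ^ 2:]"
  proof -
    have "(\<Sum>l\<in>{..<n} - {k}. M $$ (k, l) * P $$ (l, k)) = (\<Sum>l\<in>{..<n} - {k}. [:- (w l ^ 2):])"
      by (rule sum.cong) (use k in \<open>auto simp: Mij P_def power2_eq_square\<close>)
    then show ?thesis
      unfolding MP[OF k k] split using k
      by (simp add: Mij P_def const sum_negf power2_eq_square)
  qed
  have "det M * det P = det (M * P)"
    using det_mult[OF M P] by simp
  moreover have "det P = ?X * det (mat_delete P k k)"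
    using det_row_single[OF P k] k by (simp add: P_def)
  moreover have "mat_delete P k k = 1 \<cdot>\<^sub>m 1\<^sub>m (n - 1)"
    by (rule mat_delete_eq_scalar[OF P k]) (auto simp: P_def)
  moreover have "det (M * P) = (?X ^ 2 - [:\<Sum>i\<in>{..<n} - {k}. w i ^ 2:]) * det (mat_delete (M * P) k k)"
    using det_col_single[OF mult_carrier_mat[OF M P] k leaf] hub by simp
  moreover have "mat_delete (M * P) k k = ?X \<cdot>\<^sub>m 1\<^sub>m (n - 1)"
    by (rule mat_delete_eq_scalar[OF mult_carrier_mat[OF M P] k]) (auto simp: other Mij)
  ultimately have "det M * ?X = (?X ^ 2 - [:\<Sum>i\<in>{..<n} - {k}. w i ^ 2:]) * ?X ^ (n - 1)"
    by (simp only: det_scalar_mat power_one mult_1_right)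
  also have "n - 1 = Suc (n - 2)" using n by simp
  finally have "det M * ?X = (?X ^ (n - 2) * (?X ^ 2 - [:\<Sum>i\<in>{..<n} - {k}. w i ^ 2:])) * ?X"
    by (simp only: power_Suc mult_ac)
  then have "det M = ?X ^ (n - 2) * (?X ^ 2 - [:\<Sum>i\<in>{..<n} - {k}. w i ^ 2:])"
    by (subst (asm) mult_cancel_right) simp
  then show ?thesis by (simp add: char_poly_def M_def)
qed

section \<open>Absolute sum of the roots\<close>

text \<open>
  The positivity of \<open>s\<close> keeps \<open>s\<close>, \<open>-s\<close> and 0 apart, so that the factor \<open>X^m\<close> does not raise the
  multiplicity of the roots \<open>s\<close> and \<open>-s\<close>.
\<close>

lemma abs_root_sum_even_quadratic:
  fixes s :: real
  assumes s: "s > 0" and p: "p = [:0, 1:] ^ m * ([:0, 1:] ^ 2 - [:s ^ 2:])"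
  shows "(\<Sum>x | poly p x = 0. real (order x p) * \<bar>x\<bar>) = 2 * s"
proof -
  have fact: "p = [:0, 1:] ^ m * ([:-s, 1:] * [:s, 1:])"
    by (simp add: p power2_eq_square)
  have nz: "p \<noteq> 0" unfolding fact by (intro no_zero_divisors power_not_zero) auto
  have simple: "order x p = 1" if x: "x = s \<or> x = - s" for x
  proof -
    have "order x p = order x ([:0, 1:] ^ m) + (order x [:-s, 1:] + order x [:s, 1:])"
      using nz unfolding fact by (metis mult_eq_0_iff order_mult)
    moreover have "order x ([:0, 1:] ^ m) = 0"
      using x s by (intro order_0I) auto
    moreover have "order s [:-s, 1:] = 1" "order (- s) [:s, 1:] = 1"
      using order_power_n_n[of s 1] order_power_n_n[of "- s" 1] by simp_all
    moreover have "order s [:s, 1:] = 0" "order (- s) [:- s, 1:] = 0"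
      using s by (auto intro!: order_0I)
    ultimately show ?thesis using x by auto
  qed
  have "(\<Sum>x | poly p x = 0. real (order x p) * \<bar>x\<bar>) = (\<Sum>x\<in>{s, - s}. real (order x p) * \<bar>x\<bar>)"
  proof (rule sum.mono_neutral_right)
    show "finite {x. poly p x = 0}" using poly_roots_finite[OF nz] .
    show "{s, - s} \<subseteq> {x. poly p x = 0}" by (auto simp: fact)
    show "\<forall>x\<in>{x. poly p x = 0} - {s, - s}. real (order x p) * \<bar>x\<bar> = 0"
      by (auto simp: fact square_eq_iff)
  qed
  also have "\<dots> = 2 * s" using s simple by simp
  finally show ?thesis .
qed

section \<open>The star graph\<close>

text \<open>
  The out-degree counts arcs, whereas a complete bipartite digraph is described by its pairs of
  adjacent vertices; without parallel arcs the two counts agree.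
\<close>

lemma (in nomulti_digraph) out_degree_eq_card_successors:
  "out_degree G u = card {x. (u, x) \<in> arcs_ends G}"
proof -
  have "inj_on (head G) (out_arcs G u)"
    by (rule inj_onI, rule no_multi_arcs) (auto simp: arc_to_ends_def)
  moreover have "head G ` out_arcs G u = {x. (u, x) \<in> arcs_ends G}"
    by (auto simp: arcs_ends_conv)
  ultimately show ?thesis
    unfolding out_degree_def by (metis card_image)
qed

lemma star_graph_eso_matrix:
  fixes G :: "('a, 'b) pre_digraph" and v :: "nat \<Rightarrow> 'a"
  assumes n: "n \<ge> 2" and star: "star_graph n G" and v: "bij_betw v {..<n} (verts G)"
  obtains k where "k < n"
    "eso_matrix G v = weighted_star_mat n k (\<lambda>_. real n * sqrt (real n ^ 2 - 2 * real n + 2))"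
proof -
  from star obtain U V where G: "graph G" and UV: "verts G = U \<union> V" "U \<inter> V = {}"
    and card: "card U = 1" "card V = n - 1" and arcs: "arcs_ends G = U \<times> V \<union> V \<times> U"
    unfolding star_graph_def complete_bipartite_digraph_def by blast
  interpret graph G by (rule G)
  obtain c where c: "U = {c}" using card(1) by (auto simp: card_1_singleton_iff)
  obtain k where k: "k < n" "v k = c"
  proof -
    have "c \<in> v ` {..<n}" using v UV(1) c by (simp add: bij_betw_def)
    then show thesis using that by blast
  qed
  have card_verts: "card (verts G) = n" using bij_betw_same_card[OF v] by simp
  have leaf: "v i \<in> V" if "i < n" "i \<noteq> k" for i
  proof -
    have "v i \<noteq> c" using v that k by (auto simp: bij_betw_def inj_on_def)
    moreover have "v i \<in> U \<union> V" using v that UV by (auto simp: bij_betw_def)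
    ultimately show ?thesis using c by auto
  qed
  have cV: "c \<notin> V" using UV c by auto
  have deg_hub: "out_degree G c = n - 1"
    unfolding out_degree_eq_card_successors using arcs c cV card by (simp add: arcs)
  have deg_leaf: "out_degree G x = 1" if "x \<in> V" for x
  proof -
    have "{y. (x, y) \<in> arcs_ends G} = {c}" using that cV c arcs by auto
    then show ?thesis unfolding out_degree_eq_card_successors by simp
  qed
  have adj: "(v i, v j) \<in> arcs_ends G \<longleftrightarrow> (i = k \<and> j \<noteq> k) \<or> (i \<noteq> k \<and> j = k)"
    if "i < n" "j < n" for i j
  proof -
    have "v l = c \<longleftrightarrow> l = k" "v l \<in> V \<longleftrightarrow> l \<noteq> k" if "l < n" for l
      using leaf[OF that] cV k(2) by metis+
    then show ?thesis using that by (auto simp: arcs c)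
  qed
  have hyp: "(real n - 1) ^ 2 = 1 + (real n ^ 2 - 2 * real n)"
    by (simp add: power2_eq_square algebra_simps)
  have n1: "real (n - 1) = real n - 1" using n by simp
  have "eso_matrix G v = weighted_star_mat n k (\<lambda>_. real n * sqrt (real n ^ 2 - 2 * real n + 2))"
    unfolding eso_matrix_def weighted_star_mat_def card_verts
    by (rule cong_mat) (auto simp: adj k deg_hub deg_leaf leaf n1 hyp add.commute)
  with k(1) show thesis by (rule that)
qed

theorem theorem2p4:
  fixes n :: nat and G :: "('a, 'b) pre_digraph" and v :: "nat \<Rightarrow> 'a"
  assumes "n \<ge> 2"
    and "star_graph n G"
    and "bij_betw v {..<n} (verts G)"
  shows "eso_char_poly G v =
           [:0, 1:] ^ (n - 2)
           * ([:0, 1:] ^ 2 - [:(real n - 1) * (real n ^ 4 - 2 * real n ^ 3 + 2 * real n ^ 2):])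
       \<and> eso_energy G v = 2 * real n * sqrt ((real n - 1) * (real n ^ 2 - 2 * real n + 2))"
proof -
  define q where "q = real n ^ 2 - 2 * real n + 2"
  define s where "s = real n * sqrt ((real n - 1) * q)"
  obtain k where k: "k < n"
    and mat: "eso_matrix G v = weighted_star_mat n k (\<lambda>_. real n * sqrt q)"
    using star_graph_eso_matrix[OF assms] unfolding q_def by metis
  have "q = (real n - 1) ^ 2 + 1" by (simp add: q_def power2_eq_square algebra_simps)
  then have q: "q > 0" by (simp add: add_nonneg_pos)
  have s: "s > 0" using q assms(1) by (simp add: s_def)
  have s2: "s ^ 2 = (real n - 1) * (real n ^ 2 * q)"
    using q assms(1) by (simp add: s_def power_mult_distrib)
  have "(\<Sum>i\<in>{..<n} - {k}. (real n * sqrt q) ^ 2) = s ^ 2"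
    using q k assms(1) by (simp add: s2 power_mult_distrib)
  then have cp: "eso_char_poly G v = [:0, 1:] ^ (n - 2) * ([:0, 1:] ^ 2 - [:s ^ 2:])"
    unfolding eso_char_poly_def mat char_poly_weighted_star[OF k assms(1)] by simp
  have "eigenvalue (eso_matrix G v) x \<longleftrightarrow> poly (eso_char_poly G v) x = 0" for x
    unfolding eso_char_poly_def mat by (rule eigenvalue_root_char_poly[OF weighted_star_mat_carrier])
  then have "Collect (eigenvalue (eso_matrix G v)) = {x. poly (eso_char_poly G v) x = 0}"
    by blast
  then have "eso_energy G v = 2 * s"
    unfolding eso_energy_def using abs_root_sum_even_quadratic[OF s cp] by simp
  moreover have "s ^ 2 = (real n - 1) * (real n ^ 4 - 2 * real n ^ 3 + 2 * real n ^ 2)"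
    unfolding s2 q_def by (simp add: algebra_simps power2_eq_square power3_eq_cube power4_eq_xxxx)
  ultimately show ?thesis using cp by (simp add: s_def q_def)
qed

end
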